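(* Let $p$ be an odd prime. For any integer $n$ with $2\leq n\leq p-2$, we have $\mathbf{A}_p(\mathbb{F}_p)_{S(n)^*}=\{0\}$. On the other hand, for $n=p-1$ we have $\mathbf{A}_p(\mathbb{F}_p)_{S(n)^*}\neq\{0\}$.
   Context: For a prime $p$, $T_p=\mathbb{F}_p\times\mathbb{F}_p$ and $\mathbf{A}_p(\mathbb{F}_p)$ is the set of functions $T_p\to\mathbb{F}_p$ (equivalently, $\mathbb{F}_p$-valued arrays on $\mathbb{Z}^2$ with periods $(p,0)$ and $(0,p)$). For an integer $n\ge 2$, $S(n)^*=\{(i_1,i_2)\in\mathbb{Z}^2;0\le i_1,i_2\le n-1\}\setminus\{(0,0)\}$, and $\mathbf{A}_p(\mathbb{F}_p)_{S(n)^*}$ is the set of $\mathbf{a}\in\mathbf{A}_p(\mathbb{F}_p)$ with $\sum_{\mathbf{i}\in S(n)^*}\mathbf{a}_{\mathbf{i}+\mathbf{k}}=0$ for every $\mathbf{k}$ (indices taken modulo $p$). *)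

theory Defs
  imports "Berlekamp_Zassenhaus.Finite_Field" "HOL-Library.Product_Plus"
begin

text \<open>For a type \<open>'p\<close> of prime cardinality \<open>p\<close> (class \<^class>\<open>prime_card\<close>), the type
  \<open>'p mod_ring\<close> is the field \<open>\<int>/p\<int>\<close>.\<close>

type_synonym 'p torus = "'p mod_ring \<times> 'p mod_ring"
type_synonym 'p torus_array = "'p torus \<Rightarrow> 'p mod_ring"

definition torus_proj :: "int \<times> int \<Rightarrow> 'p::prime_card torus" where
  "torus_proj i = (of_int (fst i), of_int (snd i))"

definition punctured_square :: "int \<Rightarrow> (int \<times> int) set" where
  "punctured_square n =
     {(i1, i2). 0 \<le> i1 \<and> i1 \<le> n - 1 \<and> 0 \<le> i2 \<and> i2 \<le> n - 1} - {(0, 0)}"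

text \<open>The arrays whose sum over every translate of \<open>S\<close> vanishes.  This is meant for finite \<open>S\<close>
  only.  The sum ranges over \<open>S\<close> as a subset of \<open>\<int> \<times> \<int>\<close>, not over its image in the torus, so
  points of \<open>S\<close> that are congruent modulo \<open>p\<close> count separately.\<close>

definition zero_sum_arrays :: "(int \<times> int) set \<Rightarrow> 'p::prime_card torus_array set" where
  "zero_sum_arrays S = {a. \<forall>k. (\<Sum>i\<in>S. a (torus_proj (i + k))) = 0}"

end

(* Over a ring of prime characteristic p, a difference operator in a direction of period p is
   nilpotent of order p.  Hence every nonzero translation-invariant space of arrays on the torus
   contains a nonzero array killed by both difference operators, that is, a nonzero constant.  A
   constant c has sum (n^2 - 1) c over each translate of the punctured square, and
   n^2 - 1 = (n - 1) (n + 1) is nonzero modulo p for 2 <= n <= p - 2 and zero for n = p - 1. *)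
theory Submission
  imports Defs
begin

definition forward_diff :: "'a::plus \<Rightarrow> ('a \<Rightarrow> 'b::minus) \<Rightarrow> 'a \<Rightarrow> 'b" where
  "forward_diff e f = (\<lambda>s. f (e + s) - f s)"

text \<open>Newton's forward difference formula: the shift by \<open>e\<close> is the identity plus
  \<open>forward_diff e\<close>, so its powers expand by the binomial theorem. The induction leaves
  \<open>f\<close> arbitrary because its hypothesis is applied to both \<open>f\<close> and
  \<open>forward_diff e f\<close>.\<close>

lemma newton_forward:
  fixes f :: "'a::plus \<Rightarrow> 'b::comm_ring_1"
  shows "f (((+) e ^^ n) s) = (\<Sum>j\<le>n. of_nat (n choose j) * (forward_diff e ^^ j) f s)"
proof (induction n arbitrary: f)
  case 0
  show ?case by simp
next
  case (Suc n)
  let ?D = "\<lambda>j. (forward_diff e ^^ j) f s"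
  let ?x = "((+) e ^^ n) s"
  have "f (((+) e ^^ Suc n) s) = f ?x + forward_diff e f ?x"
    by (simp add: forward_diff_def)
  also have "\<dots> = (\<Sum>j\<le>n. of_nat (n choose j) * ?D j) + (\<Sum>j\<le>n. of_nat (n choose j) * ?D (Suc j))"
    by (simp only: Suc.IH funpow_Suc_right o_apply)
  also have "(\<Sum>j\<le>n. of_nat (n choose j) * ?D j) = (\<Sum>j\<le>Suc n. of_nat (n choose j) * ?D j)"
    by (simp add: binomial_eq_0)
  also have "\<dots> = f s + (\<Sum>j\<le>n. of_nat (n choose Suc j) * ?D (Suc j))"
    by (subst sum.atMost_Suc_shift) simp
  also have "\<dots> + (\<Sum>j\<le>n. of_nat (n choose j) * ?D (Suc j))
      = f s + (\<Sum>j\<le>n. of_nat (Suc n choose Suc j) * ?D (Suc j))"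
    by (simp add: algebra_simps sum.distrib del: funpow.simps)
  also have "\<dots> = (\<Sum>j\<le>Suc n. of_nat (Suc n choose j) * ?D j)"
    by (simp add: sum.atMost_Suc_shift del: sum.atMost_Suc funpow.simps binomial_Suc_Suc)
  finally show ?case .
qed

text \<open>In characteristic \<open>p\<close> the inner binomial coefficients vanish, so Newton's
  formula for \<open>p\<close> shifts leaves only the terms \<open>j = 0\<close> and
  \<open>j = p\<close>. By periodicity the left side is \<open>f s\<close>, which cancels against
  the term \<open>j = 0\<close>.\<close>

lemma forward_diff_nilpotent:
  fixes f :: "'a::plus \<Rightarrow> 'b::comm_ring_1"
  assumes p: "prime p" "CHAR('b) = p" and period: "\<And>s. ((+) e ^^ p) s = s"
  shows "(forward_diff e ^^ p) f = (\<lambda>_. 0)"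
proof
  fix s
  let ?g = "\<lambda>j. of_nat (p choose j) * (forward_diff e ^^ j) f s"
  have p0: "0 < p" using p(1) by (rule prime_gt_0_nat)
  have "?g j = 0" if "j \<in> {..p} - {0, p}" for j
  proof -
    have "p dvd (p choose j)"
      using that p(1) by (intro dvd_choose_prime) auto
    then have "(of_nat (p choose j) :: 'b) = 0"
      using p(2) by (simp add: of_nat_eq_0_iff_char_dvd)
    then show ?thesis by simp
  qed
  then have "sum ?g {..p} = sum ?g {0, p}"
    by (intro sum.mono_neutral_right) auto
  moreover have "f s = sum ?g {..p}"
    unfolding newton_forward[symmetric] period ..
  ultimately have "f s = sum ?g {0, p}" by (rule trans[rotated])
  also have "\<dots> = f s + (forward_diff e ^^ p) f s"
    using p0 by simp
  finally have "f s = f s + (forward_diff e ^^ p) f s" .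
  then show "(forward_diff e ^^ p) f s = 0" by simp
qed

text \<open>By nilpotency the iterated differences of \<open>f\<close> reach zero. The last nonzero
  one stays in \<open>W\<close> and has difference zero, which is invariance under
  \<open>e\<close>.\<close>

lemma exists_nonzero_periodic:
  fixes W :: "('a::plus \<Rightarrow> 'b::comm_ring_1) set"
  assumes "prime p" "CHAR('b) = p" "\<And>s. ((+) e ^^ p) s = s"
    and closed: "\<And>f. f \<in> W \<Longrightarrow> forward_diff e f \<in> W"
    and f: "f \<in> W" "f \<noteq> (\<lambda>_. 0)"
  shows "\<exists>g\<in>W. g \<noteq> (\<lambda>_. 0) \<and> (\<forall>s. g (e + s) = g s)"
proof -
  let ?P = "\<lambda>j. (forward_diff e ^^ j) f = (\<lambda>_. 0)"
  have "?P p" using assms(1-3) by (rule forward_diff_nilpotent)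
  moreover have "\<not> ?P 0" using f(2) by simp
  ultimately obtain j where j: "\<not> ?P j" "?P (Suc j)"
    by (metis not0_implies_Suc exists_least_lemma[of ?P])
  let ?g = "(forward_diff e ^^ j) f"
  have "?g \<in> W"
    using f(1) closed by (induction j) auto
  moreover have "?g (e + s) = ?g s" for s
    using fun_cong[OF j(2), of s] by (simp add: forward_diff_def)
  ultimately show ?thesis using j(1) by blast
qed

lemma funpow_add_pair:
  "((+) (x :: 'a::semiring_1, y :: 'b::semiring_1) ^^ n) s = (of_nat n * x, of_nat n * y) + s"
  by (induction n) (auto simp: algebra_simps prod_eq_iff)

text \<open>The sum of the difference over the translate by \<open>l\<close> is the sum of
  \<open>a\<close> over the translate by \<open>k + l\<close> minus that over the translate by
  \<open>l\<close>; both vanish.\<close>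

lemma forward_diff_zero_sum_arrays:
  fixes a :: "'p::prime_card torus_array"
  assumes "a \<in> zero_sum_arrays S"
  shows "forward_diff (torus_proj k) a \<in> zero_sum_arrays S"
proof -
  have shift: "torus_proj k + torus_proj (i + l) = (torus_proj (i + (k + l)) :: 'p torus)" for i l
    by (simp add: torus_proj_def algebra_simps)
  show ?thesis
    using assms by (simp add: zero_sum_arrays_def forward_diff_def sum_subtractf shift del: split_paired_All)
qed

lemma card_punctured_square:
  assumes "1 \<le> n"
  shows "int (card (punctured_square n)) = (n - 1) * (n + 1)"
proof -
  have "punctured_square n = {0..n-1} \<times> {0..n-1} - {(0, 0)}"
    by (auto simp: punctured_square_def)
  then have "card (punctured_square n) = nat n * nat n - 1"
    using assms by (simp add: card_cartesian_product)
  \<comment> \<open>This bound keeps the subtraction of naturals from truncating, so that it carries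
    over to the integers.\<close>
  moreover have "1 \<le> nat n * nat n"
    using assms by (simp add: Suc_le_eq)
  ultimately show ?thesis
    using assms by (simp add: algebra_simps)
qed

text \<open>Every translate has sum \<open>c\<close> times the cardinality of the square, and a
  field has no zero divisors.\<close>

lemma const_zero_sum_arrays_iff:
  fixes c :: "'p::prime_card mod_ring"
  assumes "1 \<le> n"
  shows "(\<lambda>_. c) \<in> zero_sum_arrays (punctured_square n) \<longleftrightarrow>
    int CARD('p) dvd (n - 1) * (n + 1) \<or> c = 0"
proof -
  have "(of_nat (card (punctured_square n)) :: 'p mod_ring) = 0 \<longleftrightarrow>
      int CARD('p) dvd (n - 1) * (n + 1)"
    by (simp add: of_nat_eq_0_iff_char_dvd flip: card_punctured_square[OF assms])
  then show ?thesis
    by (simp add: zero_sum_arrays_def)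
qed

lemma zero_sum_arrays_nonzero_const:
  fixes a :: "'p::prime_card torus_array"
  assumes "a \<in> zero_sum_arrays S" "a \<noteq> (\<lambda>_. 0)"
  obtains c where "c \<noteq> 0" "(\<lambda>_. c :: 'p mod_ring) \<in> zero_sum_arrays S"
proof -
  have proj: "torus_proj (1, 0) = (1, 0 :: 'p mod_ring)" "torus_proj (0, 1) = (0 :: 'p mod_ring, 1)"
    by (simp_all add: torus_proj_def)
  have period: "((+) e ^^ CARD('p)) s = s" for e s :: "'p torus"
    by (cases e; cases s) (simp add: funpow_add_pair)
  note periodic = exists_nonzero_periodic[OF prime_card semiring_char_mod_ring period]
  have closed: "forward_diff (1, 0) f \<in> zero_sum_arrays S" if "f \<in> zero_sum_arrays S"
    for f :: "'p torus_array"
    using forward_diff_zero_sum_arrays[OF that, of "(1, 0)"] by (simp only: proj)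
  obtain b :: "'p torus_array" where b: "b \<in> zero_sum_arrays S" "b \<noteq> (\<lambda>_. 0)"
    and b1: "\<And>s. b ((1, 0) + s) = b s"
    using periodic[OF closed assms] by metis
  \<comment> \<open>Working inside \<open>W\<close> preserves the invariance in the first direction
    while the argument is repeated in the second. \<open>W\<close> is stable under the second
    difference because the two unit shifts commute.\<close>
  define W where "W = {f \<in> zero_sum_arrays S. \<forall>s. f ((1, 0 :: 'p mod_ring) + s) = (f s :: 'p mod_ring)}"
  have closed_W: "forward_diff (0, 1) f \<in> W" if "f \<in> W" for f
    using that forward_diff_zero_sum_arrays[of f S "(0, 1)"]
    by (simp add: W_def proj forward_diff_def add.left_commute[of "(1, 0)" "(0, 1)", symmetric]
        del: split_paired_All)
  have bW: "b \<in> W" using b(1) b1 by (simp add: W_def del: split_paired_All)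
  obtain g where "g \<in> W" and g0: "g \<noteq> (\<lambda>_. 0)" and g2: "\<And>s. g ((0, 1) + s) = g s"
    using periodic[OF closed_W bW b(2)] by metis
  then have g: "g \<in> zero_sum_arrays S" and g1: "\<And>s. g ((1, 0) + s) = g s"
    by (auto simp: W_def simp del: split_paired_All)
  have inv: "g (((+) e ^^ n) s) = g s" if "\<And>s. g (e + s) = g s" for e n s
    using that by (induction n) simp_all
  have "g s = g 0" for s
  proof -
    \<comment> \<open>Every residue is the image of a natural number, so unit steps from 0 reach
      every point, and \<open>g\<close> is unchanged along them.\<close>
    obtain i j where "s = (of_nat i, of_nat j)"
      using surj_of_nat_mod_ring by (metis prod.collapse)
    then have "s = ((+) (1, 0) ^^ i) (((+) (0, 1) ^^ j) 0)"
      by (simp add: funpow_add_pair zero_prod_def)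
    then show ?thesis by (simp only: inv[OF g1] inv[OF g2])
  qed
  then have "g = (\<lambda>_. g 0)" by (rule ext)
  with g g0 show ?thesis by (metis that)
qed

theorem theorem4p1:
  fixes p :: nat
  assumes "p = CARD('p::prime_card)" and "odd p"
  shows "(\<forall>n::int. 2 \<le> n \<and> n \<le> int p - 2 \<longrightarrow>
            (zero_sum_arrays (punctured_square n) :: 'p torus_array set) = {\<lambda>_. 0})
       \<and> (zero_sum_arrays (punctured_square (int p - 1)) :: 'p torus_array set) \<noteq> {\<lambda>_. 0}"
proof (intro conjI allI impI)
  fix n :: int
  assume n: "2 \<le> n \<and> n \<le> int p - 2"
  \<comment> \<open>Both \<open>n - 1\<close> and \<open>n + 1\<close> lie strictly between 0 and
    \<open>p\<close>.\<close>
  have "\<not> int p dvd n - 1" "\<not> int p dvd n + 1"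
    using n by (auto dest!: zdvd_imp_le)
  then have ndvd: "\<not> int CARD('p) dvd (n - 1) * (n + 1)"
    using prime_card_int[where 'a='p] assms(1) by (simp add: prime_dvd_mult_iff)
  have "a = (\<lambda>_. 0)" if "a \<in> zero_sum_arrays (punctured_square n)" for a :: "'p torus_array"
  proof (rule ccontr)
    assume "a \<noteq> (\<lambda>_. 0)"
    with that obtain c :: "'p mod_ring"
      where "c \<noteq> 0" "(\<lambda>_. c) \<in> zero_sum_arrays (punctured_square n)"
      by (rule zero_sum_arrays_nonzero_const)
    with ndvd n show False by (simp add: const_zero_sum_arrays_iff)
  qed
  then show "(zero_sum_arrays (punctured_square n) :: 'p torus_array set) = {\<lambda>_. 0}"
    by (auto simp: zero_sum_arrays_def)
next
  have "2 \<le> p" using assms(1) prime_card[where 'a='p] by (simp add: prime_ge_2_nat)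
  \<comment> \<open>Here the factor \<open>n + 1\<close> is \<open>p\<close> itself, so nonzero
    constants qualify.\<close>
  then have "(\<lambda>_. 1) \<in> (zero_sum_arrays (punctured_square (int p - 1)) :: 'p torus_array set)"
    using assms(1) by (simp add: const_zero_sum_arrays_iff)
  moreover have "(\<lambda>_. 1) \<noteq> (\<lambda>_. 0 :: 'p mod_ring)"
    by (simp add: fun_eq_iff)
  ultimately show "(zero_sum_arrays (punctured_square (int p - 1)) :: 'p torus_array set) \<noteq> {\<lambda>_. 0}"
    by (metis singletonD)
qed

end
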